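(* Let $\mathcal{H}_1,\mathcal{H}_2$ be Hilbert spaces over $\mathbb{F}=\mathbb{R}$ or $\mathbb{F}=\mathbb{C}$, let $K$ be a positive integer, and let $\{A_k\}_{k=1}^{K}\subset \mathcal{BC}(\mathcal{H}_1,\mathcal{H}_2)$. Assume that $\mathrm{R}(A_k)\subseteq \mathrm{N}(A_{k'}^{*})$ and $\mathrm{R}(A_k^{*})\subseteq \mathrm{N}(A_{k'})$ for each $k,k'=1,\ldots,K$, $k\neq k'$. Let $k_0\in\{1,\ldots,K\}$. If $\sum_{k=1}^{K}A_k$ is surjective, then $\sum_{k=1}^{K}A_kA_k^{*}$ is invertible and $A_{k_0}^{\dagger}$ is the unique solution $X$ of the operator equation $X\left(\sum_{k=1}^{K}A_kA_k^{*}\right)=A_{k_0}^{*}$.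
   Context: $\mathcal{BC}(\mathcal{H}_1,\mathcal{H}_2)$ is the set of bounded linear operators from $\mathcal{H}_1$ to $\mathcal{H}_2$ with closed range. $A^{*}$, $\mathrm{N}(A)$, $\mathrm{R}(A)$ denote the adjoint, null space and range of $A$. For $A\in\mathcal{BC}(\mathcal{H}_1,\mathcal{H}_2)$, the Moore--Penrose inverse $A^{\dagger}\in\mathcal{BC}(\mathcal{H}_2,\mathcal{H}_1)$ is the unique solution $X$ of $AXA=A$, $XAX=X$, $(AX)^{*}=AX$, $(XA)^{*}=XA$. *)

theory Defs
  imports "HOL-Analysis.Analysis"
begin

text \<open>The scalars are treated uniformly through a class whose only models are, up to isometric
  isomorphism respecting conjugation, the reals and the complex numbers: see the two instances
  and lemma \<open>real_or_complex_cases\<close>. Some of the axioms are redundant.\<close>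

class real_or_complex = real_normed_field +
  fixes conjg :: "'a \<Rightarrow> 'a"
  assumes conjg_add: "conjg (x + y) = conjg x + conjg y"
    and conjg_mult: "conjg (x * y) = conjg x * conjg y"
    and conjg_conjg: "conjg (conjg x) = x"
    and mult_conjg_scaleR: "x * conjg x = (norm x)\<^sup>2 *\<^sub>R 1"

instantiation real :: real_or_complex
begin
definition conjg_real :: "real \<Rightarrow> real" where "conjg_real x = x"
instance by standard (auto simp: conjg_real_def power2_eq_square)
end

instantiation complex :: real_or_complex
begin
definition conjg_complex :: "complex \<Rightarrow> complex" where "conjg_complex x = cnj x"
instance by standard (auto simp: conjg_complex_def scaleR_conv_of_real complex_norm_square[symmetric])
end

lemma mult_conjg: "x * conjg x = (of_real ((norm x)\<^sup>2) :: 'f::real_or_complex)"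
  by (simp add: mult_conjg_scaleR of_real_def)

lemma conjg_of_real: "conjg (of_real r) = (of_real r :: 'f::real_or_complex)"
proof (cases "r = 0")
  case True
  have "conjg (0::'f) = conjg 0 + conjg 0"
    using conjg_add[of "0::'f" 0] by simp
  then show ?thesis using True by simp
next
  case False
  have "of_real r * conjg (of_real r :: 'f) = of_real r * of_real r"
    using mult_conjg[of "of_real r :: 'f"] by (simp add: power2_eq_square flip: of_real_mult)
  then show ?thesis using False by simp
qed

lemma conjg_minus: "conjg (- x) = - conjg (x :: 'f::real_or_complex)"
  using conjg_mult[of "of_real (-1)" x] conjg_of_real[of "-1", where 'f='f] by simp

lemma add_conjg_Reals: "x + conjg x \<in> (\<real> :: 'f::real_or_complex set)"
proof -
  have "(1 + x) * conjg (1 + x) = 1 + (x + conjg x) + x * conjg x"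
    using conjg_of_real[of 1, where 'f='f] by (simp add: conjg_add algebra_simps)
  then have "x + conjg x = of_real ((norm (1 + x))\<^sup>2) - 1 - of_real ((norm x)\<^sup>2)"
    unfolding mult_conjg by (simp add: algebra_simps)
  then show ?thesis by (metis Reals_1 Reals_diff Reals_of_real)
qed

lemma conjg_fixed_Reals: "conjg x = x \<Longrightarrow> x \<in> (\<real> :: 'f::real_or_complex set)"
proof -
  assume "conjg x = x"
  then have "x = (x + conjg x) / 2" by simp
  then show ?thesis using add_conjg_Reals[of x]
    by (metis Reals_divide Reals_numeral)
qed

lemma real_or_complex_cases:
  "(\<forall>z::'f::real_or_complex. z \<in> \<real> \<and> conjg z = z) \<or>
   (\<exists>i::'f. i * i = - 1 \<and> conjg i = - i \<and> (\<forall>z. \<exists>a b. z = of_real a + of_real b * i))"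
proof (cases "\<forall>z::'f. conjg z = z")
  case True
  then show ?thesis using conjg_fixed_Reals by blast
next
  case False
  then obtain z :: 'f where z: "conjg z \<noteq> z" by blast
  define w where "w = z - conjg z"
  define i where "i = w / of_real (norm w)"
  have cw: "conjg (v - conjg v) = - (v - conjg v)" for v :: 'f
    using conjg_add[of v "- conjg v"] by (simp add: conjg_minus conjg_conjg)
  have w0: "w \<noteq> 0" using z by (auto simp: w_def)
  have i_alt: "i = w * of_real (1 / norm w)" by (simp add: i_def divide_inverse)
  have ci: "conjg i = - i"
    using cw[of z] unfolding i_alt conjg_mult conjg_of_real w_def[symmetric] by simp
  have "norm i = 1" using w0 by (simp add: i_def norm_divide)
  then have ii: "i * i = - 1" using mult_conjg[of i] ci
    by (metis add.inverse_inverse mult_minus_right of_real_1 power_one)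
  have "\<exists>a b. v = of_real a + of_real b * i" for v :: 'f
  proof -
    have "conjg ((v - conjg v) * i) = (v - conjg v) * i"
      unfolding conjg_mult cw ci by (simp add: algebra_simps)
    then obtain r where r: "(v - conjg v) * i = of_real r"
      using conjg_fixed_Reals Reals_cases by metis
    obtain s where s: "v + conjg v = of_real s"
      using add_conjg_Reals Reals_cases by metis
    have "(v - conjg v) * (i * i) = of_real r * i" using r by (simp add: mult.assoc[symmetric])
    then have "v - conjg v = - (of_real r * i)" using ii by (simp add: algebra_simps)
    moreover have "2 * v = (v + conjg v) + (v - conjg v)" by simp
    ultimately have "2 * v = of_real s - of_real r * i" using s by simp
    then have "v = of_real (s / 2) + of_real (- r / 2) * i" by (simp add: field_simps)
    then show ?thesis by blast
  qed
  then show ?thesis using ii ci by blast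
qed

text \<open>The norm, the metric and the completeness come from the sort \<open>banach\<close> of the
  underlying type; the last axiom makes the norm the one induced by the inner product and thus
  also gives positive definiteness. The inner product is linear in its first argument.\<close>

locale hilbert_space = vector_space scale
  for scale :: "'f::real_or_complex \<Rightarrow> 'a::banach \<Rightarrow> 'a" +
  fixes ip :: "'a \<Rightarrow> 'a \<Rightarrow> 'f"
  assumes scale_of_real: "scale (of_real r) x = r *\<^sub>R x"
    and ip_add_left: "ip (x + y) z = ip x z + ip y z"
    and ip_scale_left: "ip (scale c x) y = c * ip x y"
    and ip_commute: "ip x y = conjg (ip y x)"
    and ip_self: "ip x x = of_real ((norm x)\<^sup>2)"

lemma hilbert_space_real:
  "hilbert_space scaleR (inner :: 'a::{real_inner,banach} \<Rightarrow> 'a \<Rightarrow> real)"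
  by unfold_locales
    (auto simp: conjg_real_def inner_commute inner_add_left inner_left_distrib algebra_simps power2_norm_eq_inner)

lemma hilbert_space_complex: "hilbert_space (*) (\<lambda>x y :: complex. x * cnj y)"
  by unfold_locales
    (auto simp: conjg_complex_def scaleR_conv_of_real algebra_simps complex_norm_square[symmetric])

definition bounded_ops ::
  "('f::real_or_complex \<Rightarrow> 'a::banach \<Rightarrow> 'a) \<Rightarrow> ('f \<Rightarrow> 'b::banach \<Rightarrow> 'b) \<Rightarrow> ('a \<Rightarrow> 'b) set" where
  "bounded_ops sc1 sc2 = {A. Vector_Spaces.linear sc1 sc2 A \<and> bounded_linear A}"

definition closed_range_ops ::
  "('f::real_or_complex \<Rightarrow> 'a::banach \<Rightarrow> 'a) \<Rightarrow> ('f \<Rightarrow> 'b::banach \<Rightarrow> 'b) \<Rightarrow> ('a \<Rightarrow> 'b) set" where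
  "closed_range_ops sc1 sc2 = {A \<in> bounded_ops sc1 sc2. closed (range A)}"

definition null_space :: "('a \<Rightarrow> 'b::zero) \<Rightarrow> 'a set" where
  "null_space A = {x. A x = 0}"

text \<open>The adjoint of a bounded operator exists by the Riesz representation theorem and is unique
  since the inner product is definite.\<close>

definition hilbert_adjoint ::
  "('a \<Rightarrow> 'a \<Rightarrow> 'f) \<Rightarrow> ('b \<Rightarrow> 'b \<Rightarrow> 'f) \<Rightarrow> ('a \<Rightarrow> 'b) \<Rightarrow> 'b \<Rightarrow> 'a" where
  "hilbert_adjoint ip1 ip2 A = (THE B. \<forall>x y. ip2 (A x) y = ip1 x (B y))"

definition moore_penrose ::
  "('f::real_or_complex \<Rightarrow> 'a::banach \<Rightarrow> 'a) \<Rightarrow> ('a \<Rightarrow> 'a \<Rightarrow> 'f) \<Rightarrow>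
   ('f \<Rightarrow> 'b::banach \<Rightarrow> 'b) \<Rightarrow> ('b \<Rightarrow> 'b \<Rightarrow> 'f) \<Rightarrow> ('a \<Rightarrow> 'b) \<Rightarrow> 'b \<Rightarrow> 'a" where
  "moore_penrose sc1 ip1 sc2 ip2 A = (THE X. X \<in> closed_range_ops sc2 sc1 \<and>
     A \<circ> X \<circ> A = A \<and> X \<circ> A \<circ> X = X \<and>
     hilbert_adjoint ip2 ip2 (A \<circ> X) = A \<circ> X \<and>
     hilbert_adjoint ip1 ip1 (X \<circ> A) = X \<circ> A)"

definition invertible_op :: "('f::real_or_complex \<Rightarrow> 'a::banach \<Rightarrow> 'a) \<Rightarrow> ('a \<Rightarrow> 'a) \<Rightarrow> bool" where
  "invertible_op sc S \<longleftrightarrow>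
     S \<in> bounded_ops sc sc \<and> (\<exists>T \<in> bounded_ops sc sc. T \<circ> S = id \<and> S \<circ> T = id)"

end

theory Submission
  imports Defs
begin

text \<open>Put \<open>T = A\<^sub>1 + \<dots> + A\<^sub>K\<close>. The cross terms \<open>A\<^sub>j A\<^sub>k\<^sup>*\<close> vanish, so
  \<open>S = A\<^sub>1 A\<^sub>1\<^sup>* + \<dots> + A\<^sub>K A\<^sub>K\<^sup>*\<close> equals \<open>T T\<^sup>*\<close>. By uniform boundedness the adjoint of the
  surjective \<open>T\<close> is bounded below, hence \<open>S\<close> is invertible and the equation \<open>X S = A\<^sup>*\<close>, with
  \<open>A\<close> one of the \<open>A\<^sub>k\<close>, has the unique solution \<open>A\<^sup>* S\<^sup>-\<^sup>1\<close>. Since \<open>S A = A A\<^sup>* A\<close>, the operator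
  \<open>S\<close> commutes with \<open>A A\<^sup>*\<close>, and the Penrose equations for \<open>A\<^sup>* S\<^sup>-\<^sup>1\<close> follow algebraically.\<close>

section \<open>Uniform boundedness\<close>

text \<open>Baire category: the closed sets \<open>C n\<close>, on which all \<open>f i\<close> have
  norm at most \<open>n\<close>, cover the complete space, so one of them contains a ball.
  Differences of points of that ball then give a bound that is the same for every
  \<open>i\<close>.\<close>

theorem uniform_boundedness:
  fixes f :: "'i \<Rightarrow> 'a::banach \<Rightarrow> 'c::real_normed_vector"
  assumes lin: "\<And>i. i \<in> I \<Longrightarrow> bounded_linear (f i)"
    and bdd: "\<And>x. \<exists>C. \<forall>i\<in>I. norm (f i x) \<le> C"
  shows "\<exists>C. \<forall>i\<in>I. \<forall>x. norm (f i x) \<le> C * norm x"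
proof -
  define C where "C n = {x. \<forall>i\<in>I. norm (f i x) \<le> real n}" for n
  have C_Inter: "C n = (\<Inter>i\<in>I. {x. norm (f i x) \<le> real n})" for n
    by (auto simp: C_def)
  have "closed {x. norm (f i x) \<le> real n}" if "i \<in> I" for i n
    using lin[OF that] by (intro closed_Collect_le continuous_intros linear_continuous_on)
  then have closed: "closed (C n)" for n
    unfolding C_Inter by blast
  have "x \<in> (\<Union>n. C n)" for x
  proof -
    obtain B where "\<forall>i\<in>I. norm (f i x) \<le> B" using bdd by blast
    moreover obtain n where "B \<le> real n" using real_arch_simple by blast
    ultimately have "x \<in> C n" by (force simp: C_def)
    then show ?thesis by blast
  qed
  then have "(\<Union>n. C n) = UNIV" by blast
  moreover have "completely_metrizable_space (euclidean :: 'a topology)"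
    by (rule completely_metrizable_space_euclidean)
  ultimately have "\<exists>n. interior (C n) \<noteq> {}"
    using Baire_category_alt[of euclidean "range C"] closed by fastforce
  then obtain n x0 e where e: "e > 0" "ball x0 e \<subseteq> C n"
    by (meson ex_in_conv mem_interior)
  have "norm (f i x) \<le> (4 * real n / e) * norm x" if i: "i \<in> I" for i x
  proof (cases "x = 0")
    case True
    interpret bounded_linear "f i" using lin i .
    show ?thesis using True by (simp add: zero)
  next
    case False
    interpret bounded_linear "f i" using lin i .
    \<comment> \<open>This gives \<open>t *\<^sub>R x\<close> the norm \<open>e / 2\<close>, so
      \<open>x0 + t *\<^sub>R x\<close> stays in the ball. The image of \<open>t *\<^sub>R x\<close>
      is then a difference of two values of norm at most \<open>n\<close>, whence the factor
      \<open>4 * real n / e\<close>.\<close>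
    define t where "t = e / (2 * norm x)"
    have t: "t > 0" using e False by (simp add: t_def)
    have "norm (t *\<^sub>R x) < e" using e False by (simp add: t_def)
    then have "x0 + t *\<^sub>R x \<in> C n" "x0 \<in> C n"
      using e by (auto simp: dist_norm intro!: subsetD[OF e(2)])
    then have "norm (f i (x0 + t *\<^sub>R x)) \<le> real n" "norm (f i x0) \<le> real n"
      using i by (auto simp: C_def)
    moreover have "t *\<^sub>R f i x = f i (x0 + t *\<^sub>R x) - f i x0"
      by (simp add: add scaleR)
    ultimately have "norm (t *\<^sub>R f i x) \<le> real n + real n"
      by (metis add_mono norm_triangle_le_diff)
    then have "t * norm (f i x) \<le> 2 * real n" using t by simp
    then have "norm (f i x) \<le> 2 * real n / t" using t by (simp add: field_simps)
    also have "\<dots> = (4 * real n / e) * norm x" using e False by (simp add: t_def)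
    finally show ?thesis .
  qed
  then show ?thesis by blast
qed

section \<open>Inner product and Riesz representation\<close>

lemma conjg_0 [simp]: "conjg (0::'f::real_or_complex) = 0"
  using conjg_of_real[of 0, where 'f='f] by simp

context hilbert_space
begin

section \<open>Sesquilinearity and definiteness of the inner product\<close>

lemma ip_add_right: "ip x (y + z) = ip x y + ip x z"
  using ip_add_left[of y z x] ip_commute by (metis conjg_add)

lemma ip_scale_right: "ip x (scale c y) = conjg c * ip x y"
  using ip_scale_left[of c y x] ip_commute by (metis conjg_mult)

lemma ip_scaleR_left: "ip (r *\<^sub>R x) y = of_real r * ip x y"
  by (metis scale_of_real ip_scale_left)

lemma ip_scaleR_right: "ip x (r *\<^sub>R y) = of_real r * ip x y"
  by (metis scale_of_real ip_scale_right conjg_of_real)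

lemma ip_zero_left [simp]: "ip 0 y = 0"
  using ip_scaleR_left[of 0 0 y] by simp

lemma ip_zero_right [simp]: "ip x 0 = 0"
  using ip_scaleR_right[of x 0 0] by simp

lemma ip_minus_left: "ip (- x) y = - ip x y"
  using ip_scaleR_left[of "-1" x y] by simp

lemma ip_minus_right: "ip x (- y) = - ip x y"
  using ip_scaleR_right[of x "-1" y] by simp

lemma ip_diff_left: "ip (x - y) z = ip x z - ip y z"
  by (metis diff_conv_add_uminus ip_add_left ip_minus_left)

lemma ip_diff_right: "ip x (y - z) = ip x y - ip x z"
  by (metis diff_conv_add_uminus ip_add_right ip_minus_right)

lemma ip_sum_left: "ip (\<Sum>i\<in>I. x i) y = (\<Sum>i\<in>I. ip (x i) y)"
  by (induction I rule: infinite_finite_induct) (auto simp: ip_add_left)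

lemma ip_sum_right: "ip x (\<Sum>i\<in>I. y i) = (\<Sum>i\<in>I. ip x (y i))"
  by (induction I rule: infinite_finite_induct) (auto simp: ip_add_right)

lemma ip_swap_zero: "ip x y = 0 \<Longrightarrow> ip y x = 0"
  using ip_commute by (metis conjg_0)

lemma ip_eqI_right: "(\<And>x. ip x y = ip x z) \<Longrightarrow> y = z"
proof -
  assume "\<And>x. ip x y = ip x z"
  then have "ip (y - z) (y - z) = 0" by (simp add: ip_diff_right)
  then show "y = z" by (simp add: ip_self)
qed

lemma ip_eqI_left: "(\<And>y. ip x y = ip z y) \<Longrightarrow> x = z"
  by (metis ip_eqI_right ip_commute)

lemma norm_ip_self: "norm (ip x x) = (norm x)\<^sup>2"
  unfolding ip_self norm_of_real by simp

lemma norm_scale: "norm (scale c x) = norm c * norm x"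
proof -
  have "ip (scale c x) (scale c x) = (c * conjg c) * ip x x"
    by (simp add: ip_scale_left ip_scale_right)
  then have "(norm (scale c x))\<^sup>2 = (norm c)\<^sup>2 * (norm x)\<^sup>2"
    unfolding ip_self mult_conjg of_real_mult[symmetric] of_real_eq_iff .
  then show ?thesis
    using power2_eq_imp_eq[of "norm (scale c x)" "norm c * norm x"] by (simp add: power_mult_distrib)
qed

section \<open>Pythagoras, parallelogram law and Cauchy-Schwarz\<close>

lemma norm_add_orthogonal:
  assumes "ip x y = 0"
  shows "(norm (x + y))\<^sup>2 = (norm x)\<^sup>2 + (norm y)\<^sup>2"
proof -
  have "(of_real ((norm (x + y))\<^sup>2) :: 'f) = of_real ((norm x)\<^sup>2 + (norm y)\<^sup>2)"
    unfolding of_real_add ip_self[symmetric]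
    using assms ip_swap_zero[OF assms] by (simp add: ip_add_left ip_add_right)
  then show ?thesis unfolding of_real_eq_iff .
qed

lemma parallelogram:
  fixes x y :: 'a
  shows "(norm (x + y))\<^sup>2 + (norm (x - y))\<^sup>2 = 2 * (norm x)\<^sup>2 + 2 * (norm y)\<^sup>2"
proof -
  have "ip (x + y) (x + y) + ip (x - y) (x - y) = 2 * ip x x + 2 * ip y y"
    unfolding ip_add_left ip_add_right ip_diff_left ip_diff_right by (simp add: algebra_simps)
  then have "(of_real ((norm (x + y))\<^sup>2 + (norm (x - y))\<^sup>2) :: 'f) =
    of_real (2 * (norm x)\<^sup>2 + 2 * (norm y)\<^sup>2)"
    unfolding ip_self by simp
  then show ?thesis unfolding of_real_eq_iff .
qed

lemma projection_orthogonal: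
  assumes "y \<noteq> 0"
  shows "ip (x - scale (ip x y / of_real ((norm y)\<^sup>2)) y) y = 0"
  using assms by (simp add: ip_diff_left ip_scale_left ip_self)

text \<open>Pythagoras for the splitting of \<open>x\<close> into its component along
  \<open>y\<close> and an orthogonal remainder. Dropping the remainder gives Cauchy-Schwarz; reading
  the last term as a drop in norm gives the orthogonality in the Riesz theorem.\<close>

lemma projection_norm:
  assumes "y \<noteq> 0"
  shows "(norm x)\<^sup>2 = (norm (x - scale (ip x y / of_real ((norm y)\<^sup>2)) y))\<^sup>2 + (norm (ip x y))\<^sup>2 / (norm y)\<^sup>2"
proof -
  define c where "c = ip x y / of_real ((norm y)\<^sup>2)"
  have "ip (x - scale c y) (scale c y) = 0"
    using projection_orthogonal[OF assms, of x] by (simp add: ip_scale_right c_def)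
  from norm_add_orthogonal[OF this]
  have "(norm x)\<^sup>2 = (norm (x - scale c y))\<^sup>2 + (norm c * norm y)\<^sup>2"
    by (simp add: norm_scale)
  moreover have "norm c * norm y = norm (ip x y) / norm y"
    using assms by (simp add: c_def norm_divide norm_power) (simp add: power2_eq_square)
  ultimately show ?thesis by (simp add: c_def power_divide)
qed

lemma cauchy_schwarz: "norm (ip x y) \<le> norm x * norm y"
proof (cases "y = 0")
  case False
  have "(norm (ip x y))\<^sup>2 / (norm y)\<^sup>2 \<le> (norm x)\<^sup>2"
    using projection_norm[OF False, of x] by simp
  then have "(norm (ip x y))\<^sup>2 \<le> (norm x * norm y)\<^sup>2"
    using False by (simp add: power_mult_distrib divide_le_eq)
  then show ?thesis by (rule power2_le_imp_le) simp
qed simp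

lemma bounded_linear_ip_left: "bounded_linear (\<lambda>x. ip x y)"
  by (rule bounded_linear_intro[where K = "norm y"])
    (auto simp: ip_add_left ip_scaleR_left cauchy_schwarz scaleR_conv_of_real)

section \<open>Riesz representation\<close>

text \<open>The representing vector is a multiple of the vector of least norm in the hyperplane
  on which the functional is 1.\<close>

theorem riesz_representation:
  assumes f: "bounded_linear f" and f_scale: "\<And>c x. f (scale c x) = c * f x"
  shows "\<exists>y. \<forall>x. f x = ip x y"
proof (cases "\<forall>x. f x = 0")
  case True
  then show ?thesis by (intro exI[of _ 0]) simp
next
  case False
  interpret f: bounded_linear f by (rule f)
  from False obtain x0 where x0: "f x0 \<noteq> 0" by blast
  define H where "H = {z. f z = 1}"
  define D where "D = (INF z\<in>H. (norm z)\<^sup>2)"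
  have "scale (1 / f x0) x0 \<in> H" using x0 by (simp add: H_def f_scale)
  then have ne: "H \<noteq> {}" by blast
  have bdd: "bdd_below ((\<lambda>z. (norm z)\<^sup>2) ` H)" by (intro bdd_belowI[of _ 0]) auto
  have D_le: "D \<le> (norm z)\<^sup>2" if "z \<in> H" for z
    unfolding D_def using bdd that by (rule cINF_lower)
  have "\<exists>z\<in>H. (norm z)\<^sup>2 < D + 1 / real (Suc n)" for n
    using cINF_less_iff[OF ne bdd, of "D + 1 / real (Suc n)"] by (simp add: D_def)
  then obtain s where s: "\<And>n. s n \<in> H" "\<And>n. (norm (s n))\<^sup>2 < D + 1 / real (Suc n)"
    by metis
  have diff: "(norm (s m - s n))\<^sup>2 \<le> 2 / real (Suc m) + 2 / real (Suc n)" for m n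
  proof -
    \<comment> \<open>The hyperplane contains midpoints, so the sum of two nearly minimal vectors
      cannot be short; by the parallelogram law their difference is.\<close>
    have "(1/2) *\<^sub>R (s m + s n) \<in> H"
      using s(1)[of m] s(1)[of n] by (simp add: H_def f.add f.scaleR scaleR_conv_of_real)
    from D_le[OF this] have "4 * D \<le> (norm (s m + s n))\<^sup>2"
      by (simp add: power_divide)
    then show ?thesis
      using parallelogram[of "s m" "s n"] s(2)[of m] s(2)[of n] by simp
  qed
  have "Cauchy s"
  proof (rule metric_CauchyI)
    fix e :: real assume e: "e > 0"
    then obtain N where N: "inverse (real (Suc N)) < e\<^sup>2 / 4"
      using reals_Archimedean[of "e\<^sup>2 / 4"] by auto
    have "dist (s m) (s n) < e" if "m \<ge> N" "n \<ge> N" for m n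
    proof -
      have "1 / real (Suc k) < e\<^sup>2 / 4" if "k \<ge> N" for k
        using N that by (smt (verit) frac_le inverse_eq_divide of_nat_0_less_iff of_nat_le_iff Suc_le_mono zero_less_Suc)
      from this[OF \<open>m \<ge> N\<close>] this[OF \<open>n \<ge> N\<close>] have "(norm (s m - s n))\<^sup>2 < e\<^sup>2"
        using diff[of m n] by simp
      then show ?thesis using e by (simp add: dist_norm power_less_imp_less_base)
    qed
    then show "\<exists>N. \<forall>m\<ge>N. \<forall>n\<ge>N. dist (s m) (s n) < e" by blast
  qed
  then obtain z where z: "s \<longlonglongrightarrow> z" using Cauchy_convergent convergent_def by blast
  have "(\<lambda>n. f (s n)) \<longlonglongrightarrow> f z" by (rule f.tendsto[OF z])
  then have fz: "f z = 1" using s(1) by (simp add: H_def LIMSEQ_const_iff)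
  have "(\<lambda>n. D + 1 / real (Suc n)) \<longlonglongrightarrow> D + 0"
    by (intro tendsto_add tendsto_const LIMSEQ_Suc[OF lim_1_over_n])
  then have zD: "(norm z)\<^sup>2 \<le> D"
    using s(2) by (intro LIMSEQ_le[OF tendsto_power[OF tendsto_norm[OF z]]])
      (auto intro: less_imp_le)
  have z0: "z \<noteq> 0" using fz f.zero by auto
  have orth: "ip w z = 0" if "f w = 0" for w
  proof (cases "w = 0")
    case False
    \<comment> \<open>Shifts along the kernel stay in \<open>H\<close>. Removing from
      \<open>z\<close> its component along \<open>w\<close> would lower the least norm unless that
      component is zero.\<close>
    have "z - scale c w \<in> H" for c using that fz by (simp add: H_def f.diff f_scale)
    from D_le[OF this] have "(norm (ip z w))\<^sup>2 / (norm w)\<^sup>2 \<le> 0"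
      using projection_norm[OF False, of z] zD by (smt (verit))
    then have "ip z w = 0" using False by (simp add: divide_le_0_iff)
    then show ?thesis by (rule ip_swap_zero)
  qed simp
  have "ip x (scale (1 / of_real ((norm z)\<^sup>2)) z) = f x" for x
  proof -
    \<comment> \<open>As \<open>f z = 1\<close>, this difference lies in the kernel of
      \<open>f\<close>. The normalising coefficient is real, hence its own conjugate.\<close>
    have "ip (x - scale (f x) z) z = 0" by (rule orth) (simp add: f.diff f_scale fz)
    then have "ip x z = f x * of_real ((norm z)\<^sup>2)"
      by (simp add: ip_diff_left ip_scale_left ip_self)
    moreover have "1 / of_real ((norm z)\<^sup>2) = (of_real (1 / (norm z)\<^sup>2) :: 'f)" by simp
    then have "conjg (1 / of_real ((norm z)\<^sup>2)) = (1 / of_real ((norm z)\<^sup>2) :: 'f)"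
      by (metis conjg_of_real)
    ultimately show ?thesis using z0 by (simp add: ip_scale_right)
  qed
  then show ?thesis by metis
qed

end

section \<open>Bounded operators and adjoints\<close>

text \<open>The Hilbert space assumptions supply the vector space axioms and turn homogeneity over
  the field into the real homogeneity that \<open>bounded_linear\<close> asks for.\<close>

lemma bounded_opsI:
  assumes "hilbert_space sc1 ip1" "hilbert_space sc2 ip2"
    and "\<And>x y. B (x + y) = B x + B y" "\<And>c x. B (sc1 c x) = sc2 c (B x)"
    and "\<And>x. norm (B x) \<le> M * norm x"
  shows "B \<in> bounded_ops sc1 sc2"
proof -
  interpret h1: hilbert_space sc1 ip1 by fact
  interpret h2: hilbert_space sc2 ip2 by fact
  have "Vector_Spaces.linear sc1 sc2 B"
    by unfold_locales (auto simp: assms)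
  moreover have "bounded_linear B"
    by (rule bounded_linear_intro[where K = M])
      (auto simp: assms mult.commute simp flip: h1.scale_of_real h2.scale_of_real)
  ultimately show ?thesis by (simp add: bounded_ops_def)
qed

lemma bounded_opsD:
  assumes "B \<in> bounded_ops sc1 sc2"
  shows "bounded_linear B" "B (x + y) = B x + B y" "B (x - y) = B x - B y" "B 0 = 0"
    "B (sc1 c x) = sc2 c (B x)"
proof -
  show *: "bounded_linear B" using assms by (simp add: bounded_ops_def)
  interpret bounded_linear B by (rule *)
  interpret l: Vector_Spaces.linear sc1 sc2 B using assms by (simp add: bounded_ops_def)
  show "B (x + y) = B x + B y" "B (x - y) = B x - B y" "B 0 = 0" by (rule add diff zero)+
  show "B (sc1 c x) = sc2 c (B x)" by (rule l.scale)
qed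

lemma bounded_ops_bound:
  assumes "B \<in> bounded_ops sc1 sc2"
  shows "\<exists>M>0. \<forall>x. norm (B x) \<le> M * norm x"
  using bounded_linear.pos_bounded[OF bounded_opsD(1)[OF assms]] by (simp add: mult.commute)

lemma bounded_ops_comp:
  assumes "B \<in> bounded_ops sc2 sc3" "C \<in> bounded_ops sc1 sc2"
  shows "B \<circ> C \<in> bounded_ops sc1 sc3"
  using assms bounded_linear_compose[of B C] Vector_Spaces.linear_compose[of sc1 sc2 C sc3 B]
  by (auto simp: bounded_ops_def o_def)

lemma bounded_ops_sum:
  assumes "hilbert_space sc1 ip1" "hilbert_space sc2 ip2"
    and "\<And>i. i \<in> I \<Longrightarrow> B i \<in> bounded_ops sc1 sc2"
  shows "(\<lambda>x. \<Sum>i\<in>I. B i x) \<in> bounded_ops sc1 sc2"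
proof -
  interpret h1: hilbert_space sc1 ip1 by fact
  interpret h2: hilbert_space sc2 ip2 by fact
  have "Vector_Spaces.linear sc1 sc2 (\<lambda>x. \<Sum>i\<in>I. B i x)"
    by unfold_locales
      (auto simp: bounded_opsD[OF assms(3)] sum.distrib h2.scale_sum_right)
  moreover have "bounded_linear (\<lambda>x. \<Sum>i\<in>I. B i x)"
    using assms(3) by (intro bounded_linear_sum) (auto simp: bounded_ops_def)
  ultimately show ?thesis by (simp add: bounded_ops_def)
qed

text \<open>Riesz applied to each functional \<open>\<lambda>x. ip2 (A x) y\<close> yields the
  candidate \<open>B0\<close>. Definiteness makes it unique, hence equal to the \<open>THE\<close>
  term, and also linear; its bound comes from testing the adjoint identity at
  \<open>x = B0 y\<close>.\<close>

lemma
  assumes "hilbert_space sc1 ip1" "hilbert_space sc2 ip2" "A \<in> bounded_ops sc1 sc2"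
  shows hilbert_adjoint: "ip2 (A x) y = ip1 x (hilbert_adjoint ip1 ip2 A y)"
    and hilbert_adjoint_bounded_ops: "hilbert_adjoint ip1 ip2 A \<in> bounded_ops sc2 sc1"
    and hilbert_adjoint_eqI: "(\<And>x y. ip2 (A x) y = ip1 x (B y)) \<Longrightarrow> hilbert_adjoint ip1 ip2 A = B"
proof -
  interpret h1: hilbert_space sc1 ip1 by fact
  interpret h2: hilbert_space sc2 ip2 by fact
  have "\<exists>z. \<forall>x. ip2 (A x) y = ip1 x z" for y
    using h1.riesz_representation[of "\<lambda>x. ip2 (A x) y"]
      bounded_linear_compose[OF h2.bounded_linear_ip_left[of y] bounded_opsD(1)[OF assms(3)]]
    by (simp add: bounded_opsD[OF assms(3)] h2.ip_scale_left)
  then obtain B0 where B0: "\<And>x y. ip2 (A x) y = ip1 x (B0 y)" by metis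
  have unique: "B = C" if "\<And>x y. ip2 (A x) y = ip1 x (B y)" "\<And>x y. ip2 (A x) y = ip1 x (C y)" for B C
    using that by (intro ext h1.ip_eqI_right) metis
  have eq: "hilbert_adjoint ip1 ip2 A = B" if "\<And>x y. ip2 (A x) y = ip1 x (B y)" for B
    unfolding hilbert_adjoint_def using that by (intro the_equality) (auto intro: unique)
  then show "(\<And>x y. ip2 (A x) y = ip1 x (B y)) \<Longrightarrow> hilbert_adjoint ip1 ip2 A = B" .
  show adj: "ip2 (A x) y = ip1 x (hilbert_adjoint ip1 ip2 A y)" for x y
    using eq[OF B0] B0 by simp
  obtain M where M: "M > 0" "\<And>x. norm (A x) \<le> M * norm x"
    using bounded_ops_bound[OF assms(3)] by blast
  have "norm (B0 y) \<le> M * norm y" for y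
  proof -
    have "(norm (B0 y))\<^sup>2 = norm (ip2 (A (B0 y)) y)"
      by (simp add: B0 h1.norm_ip_self)
    also have "\<dots> \<le> norm (A (B0 y)) * norm y" by (rule h2.cauchy_schwarz)
    also have "\<dots> \<le> M * norm (B0 y) * norm y" by (intro mult_right_mono M) simp
    finally have "norm (B0 y) * norm (B0 y) \<le> norm (B0 y) * (M * norm y)"
      by (simp add: power2_eq_square ac_simps)
    then show ?thesis using M by (cases "B0 y = 0") auto
  qed
  moreover have "B0 (y + z) = B0 y + B0 z" for y z
    by (rule h1.ip_eqI_right) (simp add: h1.ip_add_right h2.ip_add_right flip: B0)
  moreover have "B0 (sc2 c y) = sc1 c (B0 y)" for c y
    by (rule h1.ip_eqI_right) (simp add: h1.ip_scale_right h2.ip_scale_right flip: B0)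
  ultimately show "hilbert_adjoint ip1 ip2 A \<in> bounded_ops sc2 sc1"
    unfolding eq[OF B0] by (intro bounded_opsI[OF assms(2,1)])
qed

text \<open>Let \<open>B\<close> be the adjoint. The functionals given by all \<open>y\<close> with
  \<open>norm (B y) \<le> 1\<close> are pointwise bounded: at \<open>z = T x\<close>, available by
  surjectivity, the value is \<open>ip1 x (B y)\<close>. Uniform boundedness then bounds these
  \<open>y\<close>, and scaling gives the constant.\<close>

lemma adjoint_bounded_below:
  assumes h1: "hilbert_space sc1 ip1" and h2: "hilbert_space sc2 ip2"
    and T: "T \<in> bounded_ops sc1 sc2" and "surj T"
  shows "\<exists>c>0. \<forall>y. c * norm y \<le> norm (hilbert_adjoint ip1 ip2 T y)"
proof -
  interpret h1: hilbert_space sc1 ip1 by fact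
  interpret h2: hilbert_space sc2 ip2 by fact
  define B where "B = hilbert_adjoint ip1 ip2 T"
  have adj: "ip2 (T x) y = ip1 x (B y)" for x y
    unfolding B_def by (rule hilbert_adjoint[OF h1 h2 T])
  have B: "B \<in> bounded_ops sc2 sc1"
    unfolding B_def by (rule hilbert_adjoint_bounded_ops[OF h1 h2 T])
  define I where "I = {y. norm (B y) \<le> 1}"
  have "\<exists>C. \<forall>y\<in>I. norm (ip2 z y) \<le> C" for z
  proof -
    obtain x where x: "z = T x" using \<open>surj T\<close> by blast
    have "norm (ip2 z y) \<le> norm x" if "y \<in> I" for y
      using h1.cauchy_schwarz[of x "B y"] that mult_left_mono[of "norm (B y)" 1 "norm x"]
      by (simp add: x adj I_def)
    then show ?thesis by blast
  qed
  then obtain C0 where C0: "\<And>y z. y \<in> I \<Longrightarrow> norm (ip2 z y) \<le> C0 * norm z"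
    using uniform_boundedness[of I "\<lambda>y z. ip2 z y"] h2.bounded_linear_ip_left by blast
  \<comment> \<open>The maximum makes \<open>C\<close> positive, so that \<open>1 / C\<close> can
    serve as the lower bound.\<close>
  define C where "C = max C0 1"
  have bound: "norm y \<le> C" if "y \<in> I" for y
  proof (cases "y = 0")
    case False
    have "norm y * norm y \<le> C0 * norm y"
      using C0[OF that, of y] by (simp add: h2.norm_ip_self power2_eq_square[symmetric])
    then show ?thesis using False by (simp add: C_def)
  qed (simp add: C_def)
  have "1 / C * norm y \<le> norm (B y)" for y
  proof (cases "B y = 0")
    case True
    \<comment> \<open>All multiples of \<open>y\<close> lie in the bounded set \<open>I\<close>; the
      factor \<open>C / e\<close> turns the bound \<open>C\<close> into \<open>e\<close>.\<close>
    have "norm y \<le> e" if "e > 0" for e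
    proof -
      have "(C / e) *\<^sub>R y \<in> I"
        using True bounded_opsD(1)[OF B] by (simp add: I_def linear_simps)
      from bound[OF this] have "C * norm y \<le> C * e" using that by (simp add: C_def field_simps)
      moreover have "C > 0" by (simp add: C_def)
      ultimately show ?thesis by simp
    qed
    then have "norm y \<le> 0" using field_le_epsilon[of "norm y" 0] by simp
    then show ?thesis by simp
  next
    case False
    have "(1 / norm (B y)) *\<^sub>R y \<in> I"
      using False bounded_opsD(1)[OF B] by (simp add: I_def linear_simps)
    from bound[OF this] show ?thesis using False by (simp add: C_def field_simps)
  qed
  moreover have "1 / C > 0" by (simp add: C_def)
  ultimately show ?thesis unfolding B_def by blast
qed

section \<open>Invertibility of a surjective operator times its adjoint\<close>

text \<open>With \<open>M\<close> bounding \<open>T\<close>, the map \<open>y \<mapsto> y - (T T\<^sup>* y - b) / M\<^sup>2\<close> is a contraction,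
  which gives surjectivity of \<open>T T\<^sup>*\<close>.\<close>

lemma surj_imp_invertible_comp_adjoint:
  fixes sc1 :: "'f::real_or_complex \<Rightarrow> 'a::banach \<Rightarrow> 'a" and ip1 :: "'a \<Rightarrow> 'a \<Rightarrow> 'f"
    and sc2 :: "'f \<Rightarrow> 'b::banach \<Rightarrow> 'b" and ip2 :: "'b \<Rightarrow> 'b \<Rightarrow> 'f"
  assumes h1: "hilbert_space sc1 ip1" and h2: "hilbert_space sc2 ip2"
    and T: "T \<in> bounded_ops sc1 sc2" and "surj T"
  shows "invertible_op sc2 (T \<circ> hilbert_adjoint ip1 ip2 T)"
proof -
  interpret h1: hilbert_space sc1 ip1 by fact
  interpret h2: hilbert_space sc2 ip2 by fact
  define B where "B = hilbert_adjoint ip1 ip2 T"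
  have adj: "ip2 (T x) y = ip1 x (B y)" for x y
    unfolding B_def by (rule hilbert_adjoint[OF h1 h2 T])
  have B: "B \<in> bounded_ops sc2 sc1"
    unfolding B_def by (rule hilbert_adjoint_bounded_ops[OF h1 h2 T])
  define S where "S = T \<circ> B"
  have S: "S \<in> bounded_ops sc2 sc2" unfolding S_def by (rule bounded_ops_comp[OF T B])
  have ipS: "ip2 (S y) y = of_real ((norm (B y))\<^sup>2)" for y
    by (simp add: S_def adj h1.ip_self)
  then have ipS': "ip2 y (S y) = of_real ((norm (B y))\<^sup>2)" for y
    using h2.ip_commute by (metis conjg_of_real)
  obtain c where c: "c > 0" "\<And>y. c * norm y \<le> norm (B y)"
    using adjoint_bounded_below[OF h1 h2 T \<open>surj T\<close>] unfolding B_def by blast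
  obtain M0 where M0: "M0 > 0" "\<And>x. norm (T x) \<le> M0 * norm x"
    using bounded_ops_bound[OF T] by blast
  \<comment> \<open>Adding \<open>c\<close> forces \<open>c < M\<close>, so the radicand in
    \<open>q\<close> is positive; \<open>c > 0\<close> puts \<open>q\<close> below 1.\<close>
  define M where "M = M0 + c"
  have M: "M > 0" "c < M" "norm (T x) \<le> M * norm x" for x
    using M0 c mult_right_mono[of M0 M "norm x"] order_trans[OF M0(2)[of x]]
    by (auto simp: M_def)
  \<comment> \<open>Cauchy-Schwarz for \<open>ip2 (S y) y\<close>, the squared norm of
    \<open>B y\<close>. The estimate later gives injectivity of \<open>S\<close> and the bound on
    its inverse.\<close>
  have lower: "c\<^sup>2 * norm y \<le> norm (S y)" for y
  proof -
    have "(c * norm y)\<^sup>2 \<le> (norm (B y))\<^sup>2" using c by (intro power_mono) auto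
    also have "\<dots> = norm (ip2 (S y) y)" by (simp add: ipS norm_power)
    also have "\<dots> \<le> norm (S y) * norm y" by (rule h2.cauchy_schwarz)
    finally have "norm y * (c\<^sup>2 * norm y) \<le> norm y * norm (S y)"
      by (simp add: power2_eq_square ac_simps)
    then show ?thesis by (cases "y = 0") auto
  qed
  \<comment> \<open>With this step size the quadratic term in \<open>contract\<close> is at most
    \<open>t * (norm (B y))\<^sup>2\<close>, half of the negative cross term; the other half
    supplies the decrease by the fraction \<open>c\<^sup>2 / M\<^sup>2\<close>.\<close>
  define t where "t = 1 / M\<^sup>2"
  define q where "q = sqrt (1 - c\<^sup>2 / M\<^sup>2)"
  have "c\<^sup>2 < M\<^sup>2" using M c by (intro power_strict_mono) auto
  then have q2: "0 < 1 - c\<^sup>2 / M\<^sup>2" "1 - c\<^sup>2 / M\<^sup>2 < 1" using M c by (auto simp: field_simps)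
  then have q: "0 \<le> q" "q < 1" "q\<^sup>2 = 1 - c\<^sup>2 / M\<^sup>2"
    by (auto simp: q_def real_sqrt_lt_1_iff)
  have contract: "norm (y - t *\<^sub>R S y) \<le> q * norm y" for y
  proof -
    have "ip2 (y - t *\<^sub>R S y) (y - t *\<^sub>R S y) =
      of_real ((norm y)\<^sup>2 - 2 * t * (norm (B y))\<^sup>2 + t\<^sup>2 * (norm (S y))\<^sup>2)"
      unfolding h2.ip_diff_left h2.ip_diff_right h2.ip_scaleR_left h2.ip_scaleR_right ipS ipS'
        h2.ip_self[of y] h2.ip_self[of "S y"]
      by (simp add: power2_eq_square algebra_simps)
    then have "(norm (y - t *\<^sub>R S y))\<^sup>2 = (norm y)\<^sup>2 - 2 * t * (norm (B y))\<^sup>2 + t\<^sup>2 * (norm (S y))\<^sup>2"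
      unfolding h2.ip_self of_real_eq_iff .
    moreover have "t\<^sup>2 * (norm (S y))\<^sup>2 \<le> t\<^sup>2 * (M * norm (B y))\<^sup>2"
      using M(3)[of "B y"] by (intro mult_left_mono power_mono) (auto simp: S_def)
    moreover have "t\<^sup>2 * (M * norm (B y))\<^sup>2 = t * (norm (B y))\<^sup>2"
      using M(1) by (simp add: t_def power_mult_distrib power2_eq_square)
    moreover have "t * (c * norm y)\<^sup>2 \<le> t * (norm (B y))\<^sup>2"
      using c by (intro mult_left_mono power_mono) (auto simp: t_def)
    ultimately have "(norm (y - t *\<^sub>R S y))\<^sup>2 \<le> (norm y)\<^sup>2 - t * (c * norm y)\<^sup>2"
      by linarith
    also have "\<dots> = (q * norm y)\<^sup>2"
      by (simp add: power_mult_distrib q t_def algebra_simps)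
    finally show ?thesis by (rule power2_le_imp_le) (simp add: q)
  qed
  have t0: "t > 0" using M by (simp add: t_def)
  have "\<exists>y. S y = b" for b
  proof -
    \<comment> \<open>The shift by \<open>b\<close> cancels in differences, so
      \<open>contract\<close> applies; a fixed point solves \<open>S y = b\<close> because
      \<open>t\<close> is nonzero.\<close>
    have "dist (x - t *\<^sub>R (S x - b)) (y - t *\<^sub>R (S y - b)) \<le> q * dist x y" for x y
      using contract[of "x - y"] by (simp add: dist_norm bounded_opsD[OF S] algebra_simps)
    then obtain y where "y - t *\<^sub>R (S y - b) = y"
      using banach_fix_type[OF q(1,2), of "\<lambda>y. y - t *\<^sub>R (S y - b)"] by blast
    then show ?thesis using t0 by (intro exI[of _ y]) simp
  qed
  then obtain R where R: "\<And>b. S (R b) = b" by metis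
  have inj: "x = y" if "S x = S y" for x y
    using lower[of "x - y"] that c by (simp add: bounded_opsD[OF S] mult_le_0_iff)
  have "norm (R y) \<le> (1 / c\<^sup>2) * norm y" for y
    using lower[of "R y"] c by (simp add: R field_simps)
  moreover have "R (x + y) = R x + R y" "R (sc2 a x) = sc2 a (R x)" for a x y
    by (rule inj, simp add: R bounded_opsD[OF S])+
  ultimately have "R \<in> bounded_ops sc2 sc2" by (intro bounded_opsI[OF h2 h2])
  moreover have "R (S y) = y" for y by (rule inj) (rule R)
  then have "R \<circ> S = id" "S \<circ> R = id" using R by auto
  ultimately show ?thesis using S unfolding invertible_op_def S_def B_def by blast
qed

section \<open>Moore-Penrose inverse\<close>

text \<open>The Penrose equations in pointwise form, with self-adjointness as symmetry under the
  inner product. Uniqueness: any two solutions give the same projections \<open>A X\<close> and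
  \<open>X A\<close>, and these determine \<open>X = X A X\<close>.\<close>

lemma moore_penrose_eqI:
  assumes h1: "hilbert_space sc1 ip1" and h2: "hilbert_space sc2 ip2"
    and A: "A \<in> bounded_ops sc1 sc2" and X: "X \<in> bounded_ops sc2 sc1"
    and AXA: "\<And>x. A (X (A x)) = A x" and XAX: "\<And>y. X (A (X y)) = X y"
    and AX: "\<And>y z. ip2 (A (X y)) z = ip2 y (A (X z))"
    and XA: "\<And>x z. ip1 (X (A x)) z = ip1 x (X (A z))"
  shows "moore_penrose sc1 ip1 sc2 ip2 A = X"
  unfolding moore_penrose_def
proof (rule the_equality, intro conjI)
  interpret h1: hilbert_space sc1 ip1 by fact
  interpret h2: hilbert_space sc2 ip2 by fact
  \<comment> \<open>The fixed points of a continuous map form a closed set, so closedness of the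
    range follows from \<open>XAX\<close>.\<close>
  have "range X = {x. X (A x) = x}" using XAX by (auto simp: image_iff) metis
  moreover have "closed {x. X (A x) = x}"
    using bounded_opsD(1)[OF bounded_ops_comp[OF X A]]
    by (intro closed_Collect_eq continuous_intros) (simp add: linear_continuous_on o_def)
  ultimately show "X \<in> closed_range_ops sc2 sc1"
    using X by (simp add: closed_range_ops_def)
  show "A \<circ> X \<circ> A = A" "X \<circ> A \<circ> X = X" using AXA XAX by auto
  show "hilbert_adjoint ip2 ip2 (A \<circ> X) = A \<circ> X"
    by (intro hilbert_adjoint_eqI[OF h2 h2 bounded_ops_comp[OF A X]]) (simp add: AX)
  show "hilbert_adjoint ip1 ip1 (X \<circ> A) = X \<circ> A"
    by (intro hilbert_adjoint_eqI[OF h1 h1 bounded_ops_comp[OF X A]]) (simp add: XA)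
  fix Y
  assume Y: "Y \<in> closed_range_ops sc2 sc1 \<and> A \<circ> Y \<circ> A = A \<and> Y \<circ> A \<circ> Y = Y \<and>
    hilbert_adjoint ip2 ip2 (A \<circ> Y) = A \<circ> Y \<and> hilbert_adjoint ip1 ip1 (Y \<circ> A) = Y \<circ> A"
  then have Yb: "Y \<in> bounded_ops sc2 sc1" by (simp add: closed_range_ops_def)
  have AYA: "A (Y (A x)) = A x" and YAY: "Y (A (Y y)) = Y y" for x y
    using Y by (metis comp_apply)+
  have AY: "ip2 (A (Y y)) z = ip2 y (A (Y z))" for y z
    using hilbert_adjoint[OF h2 h2 bounded_ops_comp[OF A Yb]] Y by simp
  have YA: "ip1 (Y (A x)) z = ip1 x (Y (A z))" for x z
    using hilbert_adjoint[OF h1 h1 bounded_ops_comp[OF Yb A]] Y by simp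
  \<comment> \<open>Here \<open>A X = (A Y) (A X)\<close>, and taking adjoints gives
    \<open>A X = (A X) (A Y) = A Y\<close>.\<close>
  have "A (X y) = A (Y y)" for y
  proof (rule h2.ip_eqI_left)
    fix z
    have "ip2 (A (X y)) z = ip2 (A (Y (A (X y)))) z" by (simp add: AYA)
    also have "\<dots> = ip2 (A (Y y)) z" by (simp add: AY AX AXA)
    finally show "ip2 (A (X y)) z = ip2 (A (Y y)) z" .
  qed
  \<comment> \<open>Mirror image: \<open>X A = (X A) (Y A)\<close>, whose adjoint is
    \<open>(Y A) (X A) = Y A\<close>.\<close>
  moreover have "X (A x) = Y (A x)" for x
  proof (rule h1.ip_eqI_left)
    fix z
    have "ip1 (X (A x)) z = ip1 (X (A (Y (A x)))) z" by (simp add: AYA)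
    also have "\<dots> = ip1 x (Y (A (X (A z))))" by (simp add: XA YA)
    also have "\<dots> = ip1 (Y (A x)) z" by (simp add: AXA YA)
    finally show "ip1 (X (A x)) z = ip1 (Y (A x)) z" .
  qed
  \<comment> \<open>The chain is \<open>Y = Y A Y = Y A X = X A X = X\<close>.\<close>
  ultimately have "Y y = X y" for y by (metis XAX YAY)
  then show "Y = X" by blast
qed

section \<open>Sums of operators with mutually orthogonal ranges and coranges\<close>

theorem corollary2p6:
  fixes sc1 :: "'f::real_or_complex \<Rightarrow> 'a::banach \<Rightarrow> 'a" and ip1 :: "'a \<Rightarrow> 'a \<Rightarrow> 'f"
    and sc2 :: "'f \<Rightarrow> 'b::banach \<Rightarrow> 'b" and ip2 :: "'b \<Rightarrow> 'b \<Rightarrow> 'f"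
    and A :: "nat \<Rightarrow> 'a \<Rightarrow> 'b" and K k0 :: nat
  assumes "hilbert_space sc1 ip1" and "hilbert_space sc2 ip2"
    and "K \<ge> 1"
    and "\<And>k. k \<in> {1..K} \<Longrightarrow> A k \<in> closed_range_ops sc1 sc2"
    and "\<And>k k'. k \<in> {1..K} \<Longrightarrow> k' \<in> {1..K} \<Longrightarrow> k \<noteq> k' \<Longrightarrow>
           range (A k) \<subseteq> null_space (hilbert_adjoint ip1 ip2 (A k'))"
    and "\<And>k k'. k \<in> {1..K} \<Longrightarrow> k' \<in> {1..K} \<Longrightarrow> k \<noteq> k' \<Longrightarrow>
           range (hilbert_adjoint ip1 ip2 (A k)) \<subseteq> null_space (A k')"
    and "k0 \<in> {1..K}"
    and "surj (\<lambda>x. \<Sum>k=1..K. A k x)"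
  shows "invertible_op sc2 (\<lambda>y. \<Sum>k=1..K. A k (hilbert_adjoint ip1 ip2 (A k) y)) \<and>
    {X \<in> bounded_ops sc2 sc1.
       X \<circ> (\<lambda>y. \<Sum>k=1..K. A k (hilbert_adjoint ip1 ip2 (A k) y)) = hilbert_adjoint ip1 ip2 (A k0)}
      = {moore_penrose sc1 ip1 sc2 ip2 (A k0)}"
proof -
  note h1 = assms(1) and h2 = assms(2)
  interpret h1: hilbert_space sc1 ip1 by fact
  interpret h2: hilbert_space sc2 ip2 by fact
  define B where "B k = hilbert_adjoint ip1 ip2 (A k)" for k
  define T where "T = (\<lambda>x. \<Sum>k=1..K. A k x)"
  define S where "S = (\<lambda>y. \<Sum>k=1..K. A k (B k y))"
  have A: "A k \<in> bounded_ops sc1 sc2" if "k \<in> {1..K}" for k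
    using assms(4)[OF that] by (simp add: closed_range_ops_def)
  have adj: "ip2 (A k x) y = ip1 x (B k y)" if "k \<in> {1..K}" for k x y
    unfolding B_def by (rule hilbert_adjoint[OF h1 h2 A[OF that]])
  have adj': "ip1 (B k y) x = ip2 y (A k x)" if "k \<in> {1..K}" for k x y
    using adj[OF that] h1.ip_commute h2.ip_commute by metis
  have B: "B k \<in> bounded_ops sc2 sc1" if "k \<in> {1..K}" for k
    unfolding B_def by (rule hilbert_adjoint_bounded_ops[OF h1 h2 A[OF that]])
  \<comment> \<open>\<open>AB\<close> removes the cross terms from \<open>T\<close> times its
    adjoint; \<open>BA\<close> isolates the index \<open>k0\<close> in \<open>SA\<close> and
    \<open>BS\<close>.\<close>
  have BA: "B k (A j x) = 0" and AB: "A k (B j y) = 0"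
    if "k \<in> {1..K}" "j \<in> {1..K}" "k \<noteq> j" for k j x y
    using assms(5)[of j k] assms(6)[of j k] that by (auto simp: B_def null_space_def)
  have T: "T \<in> bounded_ops sc1 sc2"
    unfolding T_def using A by (intro bounded_ops_sum[OF h1 h2])
  have adj_T: "hilbert_adjoint ip1 ip2 T = (\<lambda>y. \<Sum>k=1..K. B k y)"
    by (rule hilbert_adjoint_eqI[OF h1 h2 T])
      (simp add: T_def h1.ip_sum_right h2.ip_sum_left adj)
  have A_sum: "A k (\<Sum>j=1..K. B j y) = A k (B k y)" if k: "k \<in> {1..K}" for k y
  proof -
    have "A k (\<Sum>j=1..K. B j y) = (\<Sum>j=1..K. A k (B j y))"
      using bounded_opsD(1)[OF A[OF k]] by (rule linear_sum[OF bounded_linear.linear])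
    also have "\<dots> = (\<Sum>j=1..K. if j = k then A k (B k y) else 0)"
      using k by (intro sum.cong) (auto simp: AB)
    finally show ?thesis using k by simp
  qed
  have TS: "T \<circ> hilbert_adjoint ip1 ip2 T = S"
    unfolding adj_T by (rule ext) (simp only: T_def S_def comp_apply A_sum cong: sum.cong)
  have inv: "invertible_op sc2 S"
    using surj_imp_invertible_comp_adjoint[OF h1 h2 T] assms(8) unfolding TS by (simp add: T_def)
  then obtain R where R: "R \<in> bounded_ops sc2 sc2" "\<And>y. R (S y) = y" "\<And>y. S (R y) = y"
    unfolding invertible_op_def by (metis comp_apply id_apply)
  have S: "S \<in> bounded_ops sc2 sc2" using inv by (simp add: invertible_op_def)
  \<comment> \<open>Symmetry of \<open>S\<close> passes to its inverse: write
    \<open>y = S (R y)\<close> and \<open>z = S (R z)\<close>.\<close>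
  have "ip2 (S y) z = ip2 y (S z)" for y z
    by (simp add: S_def h2.ip_sum_left h2.ip_sum_right adj adj')
  then have R_sym: "ip2 (R y) z = ip2 y (R z)" for y z by (metis R(3))
  let ?A = "A k0" and ?B = "B k0"
  note k0 = assms(7)
  have SA: "S (?A x) = ?A (?B (?A x))" for x
  proof -
    have "S (?A x) = (\<Sum>k=1..K. if k = k0 then ?A (?B (?A x)) else 0)"
      unfolding S_def using k0 by (intro sum.cong) (auto simp: BA bounded_opsD(4)[OF A])
    then show ?thesis using k0 by simp
  qed
  have BS: "?B (S y) = ?B (?A (?B y))" for y
  proof -
    have "?B (S y) = (\<Sum>k=1..K. ?B (A k (B k y)))"
      unfolding S_def using bounded_opsD(1)[OF B[OF k0]] by (rule linear_sum[OF bounded_linear.linear])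
    also have "\<dots> = (\<Sum>k=1..K. if k = k0 then ?B (?A (?B y)) else 0)"
      using k0 by (intro sum.cong) (auto simp: BA)
    finally show ?thesis using k0 by simp
  qed
  \<comment> \<open>By \<open>SA\<close> and \<open>BS\<close>, multiplying
    \<open>?A \<circ> ?B\<close> by \<open>S\<close> on either side gives its square; it therefore
    commutes with \<open>S\<close>, hence with \<open>R\<close>.\<close>
  have comm: "?A (?B (R y)) = R (?A (?B y))" for y
    by (metis SA BS R(2,3))
  have RABA: "R (?A (?B (?A x))) = ?A x" for x by (metis SA R(2))
  have BABR: "?B (?A (?B (R y))) = ?B y" for y by (metis BS R(3))
  have X: "?B \<circ> R \<in> bounded_ops sc2 sc1" by (rule bounded_ops_comp[OF B[OF k0] R(1)])
  have mp: "moore_penrose sc1 ip1 sc2 ip2 ?A = ?B \<circ> R"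
  proof (rule moore_penrose_eqI[OF h1 h2 A[OF k0] X])
    show "?A ((?B \<circ> R) (?A x)) = ?A x" for x by (simp add: comm RABA)
    \<comment> \<open>Moving the outer \<open>R\<close> to the right leaves
      \<open>?B (?A (?B (R (R y))))\<close>, which \<open>BABR\<close> collapses.\<close>
    show "(?B \<circ> R) (?A ((?B \<circ> R) y)) = (?B \<circ> R) y" for y
      by (simp add: BABR flip: comm)
    \<comment> \<open>A product of the commuting symmetric operators \<open>?A \<circ> ?B\<close>
      and \<open>R\<close> is symmetric; in the next claim symmetry of \<open>R\<close> alone is
      conjugated by \<open>?A\<close> and its adjoint.\<close>
    show "ip2 (?A ((?B \<circ> R) y)) z = ip2 y (?A ((?B \<circ> R) z))" for y z
      by (simp add: comm R_sym adj[OF k0] adj'[OF k0])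
    show "ip1 ((?B \<circ> R) (?A x)) z = ip1 x ((?B \<circ> R) (?A z))" for x z
      by (simp add: adj'[OF k0] R_sym adj[OF k0])
  qed
  \<comment> \<open>Composing on the right with the two-sided inverse \<open>R\<close> solves the
    equation, and composing with \<open>S\<close> leads back.\<close>
  have "{X \<in> bounded_ops sc2 sc1. X \<circ> S = ?B} = {?B \<circ> R}"
  proof (intro equalityI subsetI)
    fix Y assume "Y \<in> {X \<in> bounded_ops sc2 sc1. X \<circ> S = ?B}"
    then have "?B (R y) = Y y" for y by (metis (mono_tags) mem_Collect_eq comp_apply R(3))
    then show "Y \<in> {?B \<circ> R}" by auto
  next
    fix Y assume "Y \<in> {?B \<circ> R}"
    then show "Y \<in> {X \<in> bounded_ops sc2 sc1. X \<circ> S = ?B}" using X R(2) by auto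
  qed
  with inv show ?thesis unfolding mp S_def B_def by simp
qed

end
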